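(* Let $q$ be a power of a prime number, let $n$ be a positive integer, and let $\boldsymbol{\lambda}=(\lambda_0,\lambda_1,\dots,\lambda_{n-1})\in\mathbb{F}_q^n$, with associated polynomial $\boldsymbol{\lambda}(x)=\lambda_0+\lambda_1x+\dots+\lambda_{n-1}x^{n-1}\in\mathbb{F}_q[x]$. Then ${\rm Cir}_{n,\boldsymbol{\lambda}}(\mathbb{F}_q)$ is isomorphic to $\mathbb{F}_q[x]/\langle x^n-\boldsymbol{\lambda}(x)\rangle$ as commutative $\mathbb{F}_q$-algebras.
   Context: $\mathbb{F}_q$ is the finite field of order $q$ and $M_n(\mathbb{F}_q)$ is the $\mathbb{F}_q$-algebra of all $n\times n$ matrices with entries in $\mathbb{F}_q$. For $\boldsymbol{\lambda}=(\lambda_0,\dots,\lambda_{n-1})\in\mathbb{F}_q^n$, the $\boldsymbol{\lambda}$-vector-cyclic shift is the map $\rho_{\boldsymbol{\lambda}}:\mathbb{F}_q^n\to\mathbb{F}_q^n$ given by $$\rho_{\boldsymbol{\lambda}}((v_0,v_1,\dots,v_{n-1}))=(0,v_0,v_1,\dots,v_{n-2})+v_{n-1}\boldsymbol{\lambda}=(v_{n-1}\lambda_0,\,v_0+v_{n-1}\lambda_1,\dots,v_{n-2}+v_{n-1}\lambda_{n-1}).$$ For $\boldsymbol{a}=(a_0,\dots,a_{n-1})\in\mathbb{F}_q^n$, ${\rm cir}_{\boldsymbol{\lambda}}(\boldsymbol{a})={\rm cir}_{\boldsymbol{\lambda}}(a_0,\dots,a_{n-1})\in M_n(\mathbb{F}_q)$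 is the matrix whose successive rows are $\boldsymbol{a},\rho_{\boldsymbol{\lambda}}(\boldsymbol{a}),\rho_{\boldsymbol{\lambda}}^2(\boldsymbol{a}),\dots,\rho_{\boldsymbol{\lambda}}^{n-1}(\boldsymbol{a})$. A matrix of this form is called $\boldsymbol{\lambda}$-vector-circulant, and ${\rm Cir}_{n,\boldsymbol{\lambda}}(\mathbb{F}_q)$ denotes the set of all $n\times n$ $\boldsymbol{\lambda}$-vector-circulant matrices over $\mathbb{F}_q$, with the usual matrix addition, multiplication and scalar multiplication. *)

theory Defs
  imports
    "HOL-Algebra.QuotRing"
    "HOL-Computational_Algebra.Polynomial"
    "HOL-Computational_Algebra.Primes"
    "Jordan_Normal_Form.VS_Connect"
begin

definition vec_cyclic_shift :: "nat \<Rightarrow> 'a :: comm_ring_1 vec \<Rightarrow> 'a vec \<Rightarrow> 'a vec" where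
  "vec_cyclic_shift n l v =
     vec n (\<lambda>i. if i = 0 then 0 else v $ (i - 1)) + v $ (n - 1) \<cdot>\<^sub>v l"

definition vec_circulant :: "nat \<Rightarrow> 'a :: comm_ring_1 vec \<Rightarrow> 'a vec \<Rightarrow> 'a mat" where
  "vec_circulant n l a =
     mat_of_rows n (map (\<lambda>j. (vec_cyclic_shift n l ^^ j) a) [0..<n])"

definition Cir :: "nat \<Rightarrow> 'a :: comm_ring_1 vec \<Rightarrow> 'a mat set" where
  "Cir n l = vec_circulant n l ` carrier_vec n"

definition Cir_algebra :: "nat \<Rightarrow> 'a :: comm_ring_1 vec \<Rightarrow> ('a, 'a mat) module" where
  "Cir_algebra n l = (module_mat TYPE('a) n n)\<lparr>carrier := Cir n l\<rparr>"

definition vec_poly :: "nat \<Rightarrow> 'a :: comm_ring_1 vec \<Rightarrow> 'a poly" where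
  "vec_poly n l = (\<Sum>i<n. monom (l $ i) i)"

definition poly_algebra :: "('a :: comm_ring_1, 'a poly) module" where
  "poly_algebra = \<lparr>carrier = UNIV, monoid.mult = (*), one = 1, zero = 0, add = (+),
     module.smult = Polynomial.smult\<rparr>"

text \<open>The scalar action on cosets is \<open>c (x + I) = c x + I\<close>, written with the same
  union-over-representatives encoding as \<^const>\<open>rcoset_mult\<close>, which gives the
  multiplication of \<^const>\<open>FactRing\<close>.\<close>

definition quot_algebra :: "('r, 'a) module \<Rightarrow> 'a set \<Rightarrow> ('r, 'a set) module" where
  "quot_algebra A I = ring.extend (A Quot I)
     (module.fields (\<lambda>c X. \<Union>x\<in>X. I +>\<^bsub>A\<^esub> (c \<odot>\<^bsub>A\<^esub> x)))"

definition algebra_iso ::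
    "'r ring \<Rightarrow> ('r, 'a) module \<Rightarrow> ('r, 'b) module \<Rightarrow> ('a \<Rightarrow> 'b) set" where
  "algebra_iso R A B =
     {h \<in> ring_iso A B.
        \<forall>c\<in>carrier R. \<forall>x\<in>carrier A. h (c \<odot>\<^bsub>A\<^esub> x) = c \<odot>\<^bsub>B\<^esub> h x}"

definition Cir_quotient :: "nat \<Rightarrow> 'a :: comm_ring_1 vec \<Rightarrow> ('a, 'a poly set) module" where
  "Cir_quotient n l = quot_algebra poly_algebra
     (Idl\<^bsub>poly_algebra\<^esub> {monom 1 n - vec_poly n l})"

end

theory Submission
  imports Defs
begin

text \<open>
  Write \<open>f = x\<^sup>n - \<lambda>(x)\<close>.  Identify a vector with the polynomial of degree less than \<open>n\<close>
  whose coefficients are its entries.  Since \<open>x\<^sup>n\<close> is congruent to \<open>\<lambda>(x)\<close> modulo \<open>f\<close>, the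
  \<open>\<lambda>\<close>-vector-cyclic shift becomes multiplication by \<open>x\<close> modulo \<open>f\<close>
  (\<open>vec_cyclic_shift_rem\<close>).  Hence the \<open>\<lambda>\<close>-vector-circulant matrices are exactly the matrices
  of multiplication by some polynomial \<open>g\<close> on \<open>F[x]/(f)\<close> in the basis \<open>1, x, \<dots>, x\<^sup>n\<^sup>-\<^sup>1\<close>
  (\<open>Cir_eq_range_mult_mat\<close>), rows being the images of the basis vectors.

  Sending \<open>g\<close> to its multiplication matrix is therefore an algebra homomorphism from \<open>F[x]\<close>
  onto the circulant matrices (\<open>mult_mat_epi\<close>), and two polynomials have the same matrix
  exactly when they are congruent modulo \<open>f\<close> (\<open>mult_mat_eq_iff\<close>), since the first row of the matrix
  is \<open>g mod f\<close>.  The projection of \<open>F[x]\<close> onto \<open>F[x]/(f)\<close> identifies the same pairs of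
  polynomials.  A surjective image of an algebra is an algebra
  (\<open>algebra_epi_image\<close>), and two images of one algebra under surjections with the same fibres
  are isomorphic (\<open>algebra_iso_of_common_epi\<close>).
\<close>

section \<open>Surjective algebra homomorphisms\<close>

text \<open>
  The surjective maps from \<open>A\<close> onto \<open>B\<close> that respect all the algebra operations.  Preservation of
  \<open>\<zero>\<close> is required explicitly because \<open>B\<close> is not assumed to be a ring.
\<close>

definition algebra_epi ::
    "('r, 's) ring_scheme \<Rightarrow> ('r, 'a, 'm) module_scheme \<Rightarrow> ('r, 'b, 'k) module_scheme \<Rightarrow> ('a \<Rightarrow> 'b) set"
  where
  "algebra_epi R A B =
     {h \<in> Ring.ring_hom A B. h ` carrier A = carrier B \<and> h \<zero>\<^bsub>A\<^esub> = \<zero>\<^bsub>B\<^esub> \<and>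
        (\<forall>c\<in>carrier R. \<forall>x\<in>carrier A. h (c \<odot>\<^bsub>A\<^esub> x) = c \<odot>\<^bsub>B\<^esub> h x)}"

lemma algebra_epi_image:
  fixes R (structure) and A (structure) and B (structure)
  assumes "algebra R A" and h: "h \<in> algebra_epi R A B"
  shows "algebra R B"
proof -
  interpret A: algebra R A by fact
  have surj: "\<And>y. y \<in> carrier B \<Longrightarrow> \<exists>x\<in>carrier A. y = h x"
    and cl: "\<And>x. x \<in> carrier A \<Longrightarrow> h x \<in> carrier B"
    using h by (auto simp: algebra_epi_def)
  have zero: "\<zero>\<^bsub>B\<^esub> = h \<zero>\<^bsub>A\<^esub>" and one: "\<one>\<^bsub>B\<^esub> = h \<one>\<^bsub>A\<^esub>"
    using h by (auto simp: algebra_epi_def Ring.ring_hom_def)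
  have add: "\<And>x y. x \<in> carrier A \<Longrightarrow> y \<in> carrier A \<Longrightarrow> h x \<oplus>\<^bsub>B\<^esub> h y = h (x \<oplus>\<^bsub>A\<^esub> y)"
    and mult: "\<And>x y. x \<in> carrier A \<Longrightarrow> y \<in> carrier A \<Longrightarrow> h x \<otimes>\<^bsub>B\<^esub> h y = h (x \<otimes>\<^bsub>A\<^esub> y)"
    and smult: "\<And>c x. c \<in> carrier R \<Longrightarrow> x \<in> carrier A \<Longrightarrow> c \<odot>\<^bsub>B\<^esub> h x = h (c \<odot>\<^bsub>A\<^esub> x)"
    using h by (auto simp: algebra_epi_def Ring.ring_hom_def)
  note ops = cl zero one add mult smult
  show ?thesis
  proof (rule algebraI)
    show "cring R" by (rule A.R_cring)
    show "cring B"
    proof (rule cringI)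
      show "abelian_group B"
      proof (rule abelian_groupI)
        fix x assume "x \<in> carrier B"
        then obtain a where a: "a \<in> carrier A" "x = h a" using surj by blast
        show "\<exists>y\<in>carrier B. y \<oplus>\<^bsub>B\<^esub> x = \<zero>\<^bsub>B\<^esub>"
          using a by (intro bexI[of _ "h (\<ominus>\<^bsub>A\<^esub> a)"]) (auto simp: ops A.M.l_neg)
      qed (auto dest!: surj simp: ops A.M.a_ac)
      show "comm_monoid B"
        by (rule comm_monoidI) (auto dest!: surj simp: ops A.m_ac)
    qed (auto dest!: surj simp: ops A.l_distr)
  qed (auto dest!: surj simp: ops A.smult_l_distr A.smult_r_distr A.smult_assoc1 A.smult_assoc2)
qed

lemma algebra_iso_of_common_epi:
  assumes "algebra R A" and g: "g \<in> algebra_epi R A B" and h: "h \<in> algebra_epi R A C"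
    and same_fibres: "\<And>x y. x \<in> carrier A \<Longrightarrow> y \<in> carrier A \<Longrightarrow> g x = g y \<longleftrightarrow> h x = h y"
  shows "algebra_iso R B C \<noteq> {}"
proof -
  interpret A: algebra R A by fact
  define k where "k = (\<lambda>y. h (inv_into (carrier A) g y))"
  have img: "g ` carrier A = carrier B" "h ` carrier A = carrier C"
    using g h by (auto simp: algebra_epi_def)
  have kg: "k (g x) = h x" if "x \<in> carrier A" for x
    using same_fibres[OF inv_into_into[of "g x" g "carrier A"] that] that
    by (simp add: k_def f_inv_into_f)
  have surj: "\<And>y. y \<in> carrier B \<Longrightarrow> \<exists>x\<in>carrier A. y = g x"
    using img by auto
  have g_ops: "\<one>\<^bsub>B\<^esub> = g \<one>\<^bsub>A\<^esub>"
    "\<And>x y. x \<in> carrier A \<Longrightarrow> y \<in> carrier A \<Longrightarrow> g x \<oplus>\<^bsub>B\<^esub> g y = g (x \<oplus>\<^bsub>A\<^esub> y)"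
    "\<And>x y. x \<in> carrier A \<Longrightarrow> y \<in> carrier A \<Longrightarrow> g x \<otimes>\<^bsub>B\<^esub> g y = g (x \<otimes>\<^bsub>A\<^esub> y)"
    "\<And>c x. c \<in> carrier R \<Longrightarrow> x \<in> carrier A \<Longrightarrow> c \<odot>\<^bsub>B\<^esub> g x = g (c \<odot>\<^bsub>A\<^esub> x)"
    using g by (auto simp: algebra_epi_def Ring.ring_hom_def)
  have h_ops: "h \<one>\<^bsub>A\<^esub> = \<one>\<^bsub>C\<^esub>"
    "\<And>x y. x \<in> carrier A \<Longrightarrow> y \<in> carrier A \<Longrightarrow> h (x \<oplus>\<^bsub>A\<^esub> y) = h x \<oplus>\<^bsub>C\<^esub> h y"
    "\<And>x y. x \<in> carrier A \<Longrightarrow> y \<in> carrier A \<Longrightarrow> h (x \<otimes>\<^bsub>A\<^esub> y) = h x \<otimes>\<^bsub>C\<^esub> h y"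
    "\<And>c x. c \<in> carrier R \<Longrightarrow> x \<in> carrier A \<Longrightarrow> h (c \<odot>\<^bsub>A\<^esub> x) = c \<odot>\<^bsub>C\<^esub> h x"
    "\<And>x. x \<in> carrier A \<Longrightarrow> h x \<in> carrier C"
    using h by (auto simp: algebra_epi_def Ring.ring_hom_def)
  have hom: "k \<in> Ring.ring_hom B C"
    by (rule ring_hom_memI) (auto dest!: surj simp: g_ops kg h_ops)
  have "k ` carrier B = carrier C"
    unfolding img[symmetric] image_image using kg by (intro image_cong) auto
  moreover have "inj_on k (carrier B)"
    by (rule inj_onI) (auto dest!: surj simp: kg same_fibres)
  ultimately have "k \<in> ring_iso B C"
    using hom by (simp add: ring_iso_def bij_betw_def)
  moreover have "\<forall>c\<in>carrier R. \<forall>x\<in>carrier B. k (c \<odot>\<^bsub>B\<^esub> x) = c \<odot>\<^bsub>C\<^esub> k x"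
    by (auto dest!: surj simp: g_ops kg h_ops)
  ultimately show ?thesis unfolding algebra_iso_def by blast
qed

section \<open>Quotients of algebras by ideals\<close>

lemma quot_algebra_sel:
  "carrier (quot_algebra A I) = a_rcosets\<^bsub>A\<^esub> I"
  "monoid.mult (quot_algebra A I) = rcoset_mult A I"
  "\<one>\<^bsub>quot_algebra A I\<^esub> = I +>\<^bsub>A\<^esub> \<one>\<^bsub>A\<^esub>"
  "\<zero>\<^bsub>quot_algebra A I\<^esub> = I"
  "add (quot_algebra A I) = set_add A"
  "c \<odot>\<^bsub>quot_algebra A I\<^esub> X = (\<Union>x\<in>X. I +>\<^bsub>A\<^esub> (c \<odot>\<^bsub>A\<^esub> x))"
  by (simp_all add: quot_algebra_def ring.defs module.defs FactRing_def)

lemma quot_algebra_epi: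
  fixes R (structure) and A :: "('r, 'a) module" (structure)
  assumes "algebra R A" and "ideal I A"
  shows "(\<lambda>x. I +>\<^bsub>A\<^esub> x) \<in> algebra_epi R A (quot_algebra A I)"
proof -
  interpret A: algebra R A by fact
  interpret I: ideal I A by fact
  have smult_I: "c \<odot>\<^bsub>A\<^esub> i \<in> I" if "c \<in> carrier R" "i \<in> I" for c i
  proof -
    \<comment> \<open>A ring ideal absorbs scalars because the scalar \<open>c\<close> acts as multiplication by \<open>c \<odot> \<one>\<close>.\<close>
    have "c \<odot>\<^bsub>A\<^esub> i = (c \<odot>\<^bsub>A\<^esub> \<one>\<^bsub>A\<^esub>) \<otimes>\<^bsub>A\<^esub> i"
      using that I.a_Hcarr by (simp add: A.smult_assoc2)
    then show ?thesis using that by (simp add: I.I_l_closed)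
  qed
  have smult: "(\<Union>y\<in>I +>\<^bsub>A\<^esub> x. I +>\<^bsub>A\<^esub> (c \<odot>\<^bsub>A\<^esub> y)) = I +>\<^bsub>A\<^esub> (c \<odot>\<^bsub>A\<^esub> x)"
    if cx: "c \<in> carrier R" "x \<in> carrier A" for c x
  proof -
    have "I +>\<^bsub>A\<^esub> (c \<odot>\<^bsub>A\<^esub> y) = I +>\<^bsub>A\<^esub> (c \<odot>\<^bsub>A\<^esub> x)" if y: "y \<in> I +>\<^bsub>A\<^esub> x" for y
    proof -
      obtain i where i: "i \<in> I" "y = i \<oplus>\<^bsub>A\<^esub> x"
        using y by (auto simp: a_r_coset_def')
      have "c \<odot>\<^bsub>A\<^esub> y = c \<odot>\<^bsub>A\<^esub> i \<oplus>\<^bsub>A\<^esub> c \<odot>\<^bsub>A\<^esub> x"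
        using i cx I.a_Hcarr by (simp add: A.smult_r_distr)
      then have "c \<odot>\<^bsub>A\<^esub> y \<in> I +>\<^bsub>A\<^esub> (c \<odot>\<^bsub>A\<^esub> x)"
        using smult_I[OF cx(1) i(1)] by (auto simp: a_r_coset_def')
      then show ?thesis
        using A.M.a_repr_independence[OF _ _ I.additive_subgroup_axioms[THEN additive_subgroup.a_subgroup]] cx
        by (metis A.smult_closed)
    qed
    moreover have "x \<in> I +>\<^bsub>A\<^esub> x" using cx I.a_rcos_self by blast
    ultimately show ?thesis by blast
  qed
  have "(\<lambda>x. I +>\<^bsub>A\<^esub> x) ` carrier A = carrier (quot_algebra A I)"
    by (auto simp: quot_algebra_sel A_RCOSETS_def')
  moreover have "(\<lambda>x. I +>\<^bsub>A\<^esub> x) \<in> Ring.ring_hom A (quot_algebra A I)"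
    using I.rcos_ring_hom by (simp add: Ring.ring_hom_def quot_algebra_sel FactRing_def)
  moreover have "I +>\<^bsub>A\<^esub> \<zero>\<^bsub>A\<^esub> = I"
    using I.a_rcos_const by simp
  ultimately show ?thesis
    using smult by (simp add: algebra_epi_def quot_algebra_sel)
qed

section \<open>The polynomial algebra\<close>

lemma poly_algebra_sel [simp]:
  "carrier poly_algebra = UNIV"
  "x \<otimes>\<^bsub>poly_algebra\<^esub> y = x * y"
  "\<one>\<^bsub>poly_algebra\<^esub> = 1"
  "\<zero>\<^bsub>poly_algebra\<^esub> = 0"
  "x \<oplus>\<^bsub>poly_algebra\<^esub> y = x + y"
  "c \<odot>\<^bsub>poly_algebra\<^esub> x = Polynomial.smult c x"
  by (simp_all add: poly_algebra_def)

lemma poly_algebra: "algebra class_ring (poly_algebra :: ('a :: comm_ring_1, 'a poly) module)"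
proof (rule algebraI)
  show "cring (class_ring :: 'a ring)" by (rule class_cring.is_cring)
  show "cring (poly_algebra :: ('a, 'a poly) module)"
  proof (rule cringI)
    show "abelian_group (poly_algebra :: ('a, 'a poly) module)"
    proof (rule abelian_groupI)
      fix x :: "'a poly"
      show "\<exists>y\<in>carrier poly_algebra. y \<oplus>\<^bsub>poly_algebra\<^esub> x = \<zero>\<^bsub>poly_algebra\<^esub>"
        by (intro bexI[of _ "- x"]) simp_all
    qed (auto simp: algebra_simps)
    show "comm_monoid (poly_algebra :: ('a, 'a poly) module)"
      by (rule comm_monoidI) (auto simp: algebra_simps)
  qed (auto simp: algebra_simps)
qed (auto simp: smult_add_left smult_add_right)

lemma poly_algebra_Idl:
  "Idl\<^bsub>poly_algebra\<^esub> {f} = {g :: 'a :: comm_ring_1 poly. f dvd g}"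
proof -
  interpret cring "poly_algebra :: ('a, 'a poly) module"
    using poly_algebra by (rule algebra.M_cring)
  have "Idl\<^bsub>poly_algebra\<^esub> {f} = PIdl\<^bsub>poly_algebra\<^esub> f"
    using cgenideal_eq_genideal[of f] by simp
  also have "\<dots> = {g. f dvd g}"
    by (auto simp: cgenideal_def dvd_def mult.commute)
  finally show ?thesis .
qed

lemma poly_algebra_Idl_ideal:
  "ideal (Idl\<^bsub>poly_algebra\<^esub> {f}) (poly_algebra :: ('a :: comm_ring_1, 'a poly) module)"
proof -
  interpret cring "poly_algebra :: ('a, 'a poly) module"
    using poly_algebra by (rule algebra.M_cring)
  show ?thesis by (rule genideal_ideal) simp
qed

lemma poly_algebra_coset_eq_iff:
  fixes f :: "'a :: comm_ring_1 poly"
  shows "Idl\<^bsub>poly_algebra\<^esub> {f} +>\<^bsub>poly_algebra\<^esub> g = Idl\<^bsub>poly_algebra\<^esub> {f} +>\<^bsub>poly_algebra\<^esub> h \<longleftrightarrow>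
         f dvd g - h" (is "?I +>\<^bsub>_\<^esub> g = ?I +>\<^bsub>_\<^esub> h \<longleftrightarrow> _")
proof -
  have mem: "x \<in> ?I +>\<^bsub>poly_algebra\<^esub> y \<longleftrightarrow> f dvd x - y" for x y
    by (auto simp: a_r_coset_def' poly_algebra_Idl intro: exI[of _ "x - y"])
  have "f dvd x - g \<longleftrightarrow> f dvd x - h" if "f dvd g - h" for x
    using dvd_add_left_iff[OF that, of "x - g"] by simp
  then show ?thesis
    by (auto simp: set_eq_iff mem)
qed

section \<open>Multiplication modulo a polynomial\<close>

text \<open>
  The matrix of multiplication by \<open>g\<close> modulo \<open>f\<close>: row \<open>i\<close> holds the first \<open>n\<close> coefficients of
  \<open>x\<^sup>i g mod f\<close>.  It is used for \<open>f\<close> of degree \<open>n\<close>, when these are all the coefficients.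
\<close>

definition mult_mat :: "nat \<Rightarrow> 'a :: field poly \<Rightarrow> 'a poly \<Rightarrow> 'a mat" where
  "mult_mat n f g = mat n n (\<lambda>(i, j). coeff ((monom 1 i * g) mod f) j)"

lemma mult_mat_carrier [simp]:
  "mult_mat n f g \<in> carrier_mat n n" "dim_row (mult_mat n f g) = n" "dim_col (mult_mat n f g) = n"
  by (simp_all add: mult_mat_def)

lemma degree_mod_less_of_pos:
  fixes f :: "'a :: field poly"
  assumes "degree f > 0"
  shows "degree (g mod f) < degree f"
proof (cases "g mod f = 0")
  case False
  then show ?thesis using assms degree_mod_less[of f g] by force
qed (use assms in simp)

lemma mult_mat_mod: "mult_mat n f (g mod f) = mult_mat n f g"
  by (simp add: mult_mat_def mod_mult_right_eq)

lemma mult_mat_eq_iff: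
  fixes f :: "'a :: field poly"
  assumes n: "degree f = n" "n \<ge> 1"
  shows "mult_mat n f g = mult_mat n f h \<longleftrightarrow> f dvd g - h"
proof
  assume eq: "mult_mat n f g = mult_mat n f h"
  have "coeff (g mod f) j = coeff (h mod f) j" for j
  proof (cases "j < n")
    case True
    \<comment> \<open>Row \<open>0\<close> of the matrix is the remainder itself.\<close>
    have "mult_mat n f g $$ (0, j) = mult_mat n f h $$ (0, j)" using eq by simp
    then show ?thesis using True n by (simp add: mult_mat_def)
  next
    case False
    then have "degree (g mod f) < j" "degree (h mod f) < j"
      using degree_mod_less_of_pos[of f g] degree_mod_less_of_pos[of f h] n by linarith+
    then show ?thesis by (simp add: coeff_eq_0)
  qed
  then have "g mod f = h mod f" by (simp add: poly_eq_iff)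
  then show "f dvd g - h" by (simp add: mod_eq_dvd_iff)
next
  assume "f dvd g - h"
  then have "g mod f = h mod f" by (simp add: mod_eq_dvd_iff)
  then show "mult_mat n f g = mult_mat n f h" by (metis mult_mat_mod)
qed

lemma mult_mat_add: "mult_mat n f (g + h) = mult_mat n f g + mult_mat n f h"
  by (rule eq_matI) (simp_all add: mult_mat_def distrib_left poly_mod_add_left)

lemma mult_mat_smult: "mult_mat n f (Polynomial.smult c g) = c \<cdot>\<^sub>m mult_mat n f g"
  by (rule eq_matI) (simp_all add: mult_mat_def mod_smult_left)

lemma mult_mat_zero: "mult_mat n f 0 = 0\<^sub>m n n"
  by (rule eq_matI) (simp_all add: mult_mat_def)

lemma mult_mat_one:
  assumes "degree f = n"
  shows "mult_mat n f 1 = 1\<^sub>m n"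
proof (rule eq_matI)
  fix i j assume ij: "i < dim_row (1\<^sub>m n :: 'a mat)" "j < dim_col (1\<^sub>m n :: 'a mat)"
  have "monom 1 i mod f = monom 1 i"
    using ij assms by (intro mod_poly_less) (simp add: degree_monom_eq)
  then show "mult_mat n f 1 $$ (i, j) = 1\<^sub>m n $$ (i, j)"
    using ij by (simp add: mult_mat_def)
qed simp_all

lemma coeff_mod_sum:
  fixes f :: "'a :: field poly"
  shows "coeff (sum g S mod f) j = (\<Sum>k\<in>S. coeff (g k mod f) j)"
  by (induction S rule: infinite_finite_induct) (simp_all add: poly_mod_add_left)

lemma poly_as_sum_of_monoms_less:
  assumes "degree p < n"
  shows "p = (\<Sum>k<n. monom (coeff p k) k)"
proof -
  have "{..n - 1} = {..<n}" using assms by auto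
  then show ?thesis using poly_as_sum_of_monoms'[of p "n - 1"] assms by simp
qed

lemma mult_mat_mult:
  fixes f :: "'a :: field poly"
  assumes n: "degree f = n" "n \<ge> 1"
  shows "mult_mat n f (g * h) = mult_mat n f g * mult_mat n f h"
proof (rule eq_matI)
  fix i j assume "i < dim_row (mult_mat n f g * mult_mat n f h)"
    and "j < dim_col (mult_mat n f g * mult_mat n f h)"
  then have ij: "i < n" "j < n" by simp_all
  define r where "r = (monom 1 i * g) mod f"
  have r: "r = (\<Sum>k<n. monom (coeff r k) k)"
    using poly_as_sum_of_monoms_less degree_mod_less_of_pos n unfolding r_def by force
  have "mult_mat n f (g * h) $$ (i, j) = coeff ((r * h) mod f) j"
    using ij by (simp add: mult_mat_def r_def mod_mult_left_eq mult.assoc)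
  also have "r * h = (\<Sum>k<n. Polynomial.smult (coeff r k) (monom 1 k * h))"
    by (subst r) (simp add: sum_distrib_right smult_monom flip: mult_smult_left)
  also have "coeff (\<dots> mod f) j = (\<Sum>k<n. coeff r k * coeff ((monom 1 k * h) mod f) j)"
    by (simp add: coeff_mod_sum mod_smult_left)
  also have "\<dots> = (mult_mat n f g * mult_mat n f h) $$ (i, j)"
    using ij by (simp add: mult_mat_def r_def scalar_prod_def atLeast0LessThan)
  finally show "mult_mat n f (g * h) $$ (i, j) = (mult_mat n f g * mult_mat n f h) $$ (i, j)" .
qed simp_all

section \<open>Circulant matrices as multiplication matrices\<close>

lemma coeff_vec_poly: "coeff (vec_poly n v) i = (if i < n then v $ i else 0)"
  by (simp add: vec_poly_def coeff_sum)

lemma degree_vec_poly_less: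
  assumes "n \<ge> 1"
  shows "degree (vec_poly n v) < n"
proof -
  have "degree (vec_poly n v) \<le> n - 1"
    by (rule degree_le) (auto simp: coeff_vec_poly)
  then show ?thesis using assms by linarith
qed

lemma degree_monom_minus_vec_poly:
  assumes "n \<ge> 1"
  shows "degree (monom 1 n - vec_poly n l) = n"
proof (rule antisym)
  show "degree (monom 1 n - vec_poly n l) \<le> n"
    by (rule degree_le) (auto simp: coeff_vec_poly)
  show "n \<le> degree (monom 1 n - vec_poly n l)"
    by (rule le_degree) (simp add: coeff_vec_poly)
qed

text \<open>
  Multiplying a remainder \<open>r\<close> by \<open>x\<close> can only produce degree \<open>n\<close> through the leading
  coefficient of \<open>r\<close>, and reducing \<open>x\<^sup>n\<close> to \<open>\<lambda>(x)\<close> is what the shift does with the last entry.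
\<close>

lemma vec_cyclic_shift_rem:
  fixes l :: "'a :: field vec"
  assumes n: "n \<ge> 1" and l: "l \<in> carrier_vec n" and r: "degree r < n"
  shows "vec_cyclic_shift n l (vec n (coeff r)) =
         vec n (coeff ((monom 1 1 * r) mod (monom 1 n - vec_poly n l)))"
proof -
  define f where "f = monom 1 n - vec_poly n l"
  define s where "s = monom 1 1 * r - Polynomial.smult (coeff r (n - 1)) f"
  have s: "coeff s i = (if i < n then (if i = 0 then 0 else coeff r (i - 1)) +
             coeff r (n - 1) * l $ i else 0)" for i
  proof (cases "i \<le> n")
    case True
    then show ?thesis
      using n by (auto simp: s_def f_def coeff_monom_mult coeff_vec_poly)
  next
    case False
    then have "coeff r (i - 1) = 0" using r by (intro coeff_eq_0) linarith
    then show ?thesis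
      using False by (simp add: s_def f_def coeff_monom_mult coeff_vec_poly)
  qed
  have "degree s \<le> n - 1"
    by (rule degree_le) (auto simp: s)
  then have "s mod f = s"
    using n degree_monom_minus_vec_poly[OF n, of l] by (intro mod_poly_less) (simp add: f_def)
  moreover have "(monom 1 1 * r) mod f = s mod f"
    by (simp add: s_def mod_eq_dvd_iff dvd_smult)
  ultimately have "(monom 1 1 * r) mod f = s" by simp
  then show ?thesis
    using n l by (intro eq_vecI) (auto simp: vec_cyclic_shift_def s simp flip: f_def)
qed

lemma vec_cyclic_shift_funpow:
  fixes l :: "'a :: field vec"
  assumes n: "n \<ge> 1" and l: "l \<in> carrier_vec n" and a: "a \<in> carrier_vec n"
  shows "(vec_cyclic_shift n l ^^ j) a =
         vec n (coeff ((monom 1 j * vec_poly n a) mod (monom 1 n - vec_poly n l)))"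
proof (induction j)
  case 0
  have "vec_poly n a mod (monom 1 n - vec_poly n l) = vec_poly n a"
    using degree_monom_minus_vec_poly[OF n, of l] degree_vec_poly_less[OF n, of a]
    by (intro mod_poly_less) simp
  then show ?case
    using a by (intro eq_vecI) (simp_all add: coeff_vec_poly)
next
  case (Suc j)
  have "degree ((monom 1 j * vec_poly n a) mod (monom 1 n - vec_poly n l)) < n"
    using degree_monom_minus_vec_poly[OF n, of l] n
      degree_mod_less_of_pos[of "monom 1 n - vec_poly n l" "monom 1 j * vec_poly n a"] by simp
  then show ?case
    using n l
    by (simp add: Suc.IH vec_cyclic_shift_rem mod_mult_right_eq mult_monom flip: mult.assoc)
qed

lemma vec_circulant_eq_mult_mat:
  fixes l :: "'a :: field vec"
  assumes "n \<ge> 1" and "l \<in> carrier_vec n" and "a \<in> carrier_vec n"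
  shows "vec_circulant n l a = mult_mat n (monom 1 n - vec_poly n l) (vec_poly n a)"
  by (rule eq_matI)
    (simp_all add: vec_circulant_def mult_mat_def mat_of_rows_index vec_cyclic_shift_funpow[OF assms])

lemma Cir_eq_range_mult_mat:
  fixes l :: "'a :: field vec"
  assumes n: "n \<ge> 1" and l: "l \<in> carrier_vec n"
  shows "Cir n l = range (mult_mat n (monom 1 n - vec_poly n l))"
proof -
  define f where "f = monom 1 n - vec_poly n l"
  have "mult_mat n f g \<in> Cir n l" for g
  proof -
    define a where "a = vec n (coeff (g mod f))"
    have "degree (g mod f) < n"
      using degree_mod_less_of_pos[of f g] degree_monom_minus_vec_poly[OF n, of l] n
      by (simp add: f_def)
    then have "vec_poly n a = g mod f"
      by (auto simp: poly_eq_iff coeff_vec_poly a_def coeff_eq_0)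
    then have "mult_mat n f g = vec_circulant n l a"
      using vec_circulant_eq_mult_mat[OF n l, of a] by (simp add: a_def mult_mat_mod flip: f_def)
    then show ?thesis by (simp add: Cir_def a_def)
  qed
  then show ?thesis
    using vec_circulant_eq_mult_mat[OF n l] unfolding f_def by (auto simp: Cir_def)
qed

lemma mult_mat_epi:
  fixes l :: "'a :: field vec"
  assumes n: "n \<ge> 1" and l: "l \<in> carrier_vec n"
  shows "mult_mat n (monom 1 n - vec_poly n l) \<in> algebra_epi R poly_algebra (Cir_algebra n l)"
  using degree_monom_minus_vec_poly[OF n, of l] n
  by (auto simp: algebra_epi_def Ring.ring_hom_def Cir_algebra_def module_mat_def
      Cir_eq_range_mult_mat[OF n l] mult_mat_add mult_mat_mult mult_mat_one mult_mat_zero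
      mult_mat_smult)

theorem theorem2p7:
  fixes l :: "'a :: {field, finite} vec" and n p k q :: nat
  assumes "prime p" and "k \<ge> 1" and "q = p ^ k" and "card (UNIV :: 'a set) = q"
    and "n \<ge> 1" and "l \<in> carrier_vec n"
  shows "algebra class_ring (Cir_algebra n l) \<and>
         algebra class_ring (Cir_quotient n l) \<and>
         algebra_iso class_ring (Cir_algebra n l) (Cir_quotient n l) \<noteq> {}"
proof -
  define f where "f = monom 1 n - vec_poly n l"
  define I where "I = Idl\<^bsub>poly_algebra\<^esub> {f}"
  have cir: "mult_mat n f \<in> algebra_epi class_ring poly_algebra (Cir_algebra n l)"
    using mult_mat_epi[OF \<open>n \<ge> 1\<close> \<open>l \<in> carrier_vec n\<close>] by (simp add: f_def)
  have quot: "(\<lambda>g. I +>\<^bsub>poly_algebra\<^esub> g) \<in> algebra_epi class_ring poly_algebra (Cir_quotient n l)"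
    using quot_algebra_epi[OF poly_algebra poly_algebra_Idl_ideal, of f]
    by (simp add: Cir_quotient_def f_def I_def)
  have "mult_mat n f g = mult_mat n f h \<longleftrightarrow> I +>\<^bsub>poly_algebra\<^esub> g = I +>\<^bsub>poly_algebra\<^esub> h" for g h
    using mult_mat_eq_iff[of f n g h] degree_monom_minus_vec_poly[OF \<open>n \<ge> 1\<close>, of l] \<open>n \<ge> 1\<close>
    by (simp add: poly_algebra_coset_eq_iff f_def I_def)
  then have "algebra_iso class_ring (Cir_algebra n l) (Cir_quotient n l) \<noteq> {}"
    by (intro algebra_iso_of_common_epi[OF poly_algebra cir quot]) simp
  then show ?thesis
    using algebra_epi_image[OF poly_algebra cir] algebra_epi_image[OF poly_algebra quot] by simp
qed

end
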